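(* Let $a_0,a_1,c_1,c_2$ be integers with $c_2\neq 0$, let $(W_m)_{m\in\mathbb{Z}}$ be the sequence $W_m=W_m(a_0,a_1;c_1,c_2)$, let $U_m=W_m(0,1;c_1,c_2)$, and let $\Delta=a_1^2-c_1a_0a_1-c_2a_0^2$. Let $r\ge 0$ be an integer and let $s,k,n$ be integers. Let $\mathbb{A}_n^{s,k}(r)$ be the $(r+1)\times(r+1)$ matrix whose $(i,j)$ entry is $W_{s+k(n+i+j)}^r$ for $i,j=0,1,\dots,r$. Then $$\det \mathbb{A}_n^{s,k}(r)= (-1)^{(s+kn+1)\binom{r+1}{2}}\cdot c_2^{(s+kn)\binom{r+1}{2}+2k\binom{r+1}{3}}\cdot \Delta^{\binom{r+1}{2}}\cdot \prod_{i=0}^r \binom{r}{i}U_{(i+1)k}^{2(r-i)}.$$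
   Context: For integers $a,b,c_1,c_2$ with $c_2\ne 0$, $W_m(a,b;c_1,c_2)$ denotes the second-order linear recurrence with $W_0=a$, $W_1=b$ and $W_m=c_1W_{m-1}+c_2W_{m-2}$; the recurrence is used to extend the sequence to all negative indices as well (so the terms are rational numbers and the recurrence holds for all $m\in\mathbb{Z}$). Any quantity raised to the power $0$ equals $1$ (including $0^0=1$). *)

theory Defs
  imports Complex_Main "Jordan_Normal_Form.Determinant"
begin

fun W_fwd :: "int \<Rightarrow> int \<Rightarrow> int \<Rightarrow> int \<Rightarrow> nat \<Rightarrow> rat" where
  "W_fwd a b c1 c2 0 = of_int a"
| "W_fwd a b c1 c2 (Suc 0) = of_int b"
| "W_fwd a b c1 c2 (Suc (Suc m)) =
     of_int c1 * W_fwd a b c1 c2 (Suc m) + of_int c2 * W_fwd a b c1 c2 m"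

(* W_bwd a b c1 c2 m is the term with index -m: the recurrence solved for its
   lowest-index term. *)
fun W_bwd :: "int \<Rightarrow> int \<Rightarrow> int \<Rightarrow> int \<Rightarrow> nat \<Rightarrow> rat" where
  "W_bwd a b c1 c2 0 = of_int a"
| "W_bwd a b c1 c2 (Suc 0) = (of_int b - of_int c1 * of_int a) / of_int c2"
| "W_bwd a b c1 c2 (Suc (Suc m)) =
     (W_bwd a b c1 c2 m - of_int c1 * W_bwd a b c1 c2 (Suc m)) / of_int c2"

(* Meaningful for c2 \<noteq> 0 only; W_0, W_1 and W_rec below then characterise it. *)
definition W :: "int \<Rightarrow> int \<Rightarrow> int \<Rightarrow> int \<Rightarrow> int \<Rightarrow> rat" where
  "W a b c1 c2 m =
     (if m \<ge> 0 then W_fwd a b c1 c2 (nat m) else W_bwd a b c1 c2 (nat (- m)))"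

lemma W_0: "W a b c1 c2 0 = of_int a"
  by (simp add: W_def)

lemma W_1: "W a b c1 c2 1 = of_int b"
  by (simp add: W_def)

lemma W_rec:
  assumes "c2 \<noteq> 0"
  shows "W a b c1 c2 m = of_int c1 * W a b c1 c2 (m - 1) + of_int c2 * W a b c1 c2 (m - 2)"
proof -
  consider "m \<ge> 2" | "m = 1" | "m \<le> 0" by linarith
  then show ?thesis
  proof cases
    case 1
    define k where "k = nat (m - 2)"
    have "nat m = Suc (Suc k)" "nat (m - 1) = Suc k" "nat (m - 2) = k"
      using 1 by (auto simp: k_def)
    with 1 show ?thesis by (simp add: W_def)
  next
    case 2
    with assms show ?thesis by (simp add: W_def)
  next
    case 3
    define k where "k = nat (- m)"
    have "nat (- m) = k" "nat (1 - m) = Suc k" "nat (2 - m) = Suc (Suc k)"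
      using 3 by (auto simp: k_def)
    moreover have "W a b c1 c2 m = W_bwd a b c1 c2 (nat (- m))"
      using 3 by (cases "m = 0") (auto simp: W_def)
    ultimately show ?thesis
      using 3 assms by (simp add: W_def)
  qed
qed

end

theory Submission
  imports Defs
begin

text \<open>
  The addition formula \<open>W (p + q) = U q * W (p + 1) + c2 * U (q - 1) * W p\<close> and the
  binomial theorem factor the matrix as \<open>A D B\<close>, where \<open>D\<close> is the diagonal
  matrix of the binomial coefficients and \<open>A\<close> and the transpose of \<open>B\<close> are
  homogeneous Vandermonde matrices, with rows \<open>x ^ l * y ^ (r - l)\<close>. The \<open>2 \<times> 2\<close>
  minors in the Vandermonde products are evaluated by d'Ocagne's identity. No Binet formula
  is used, so repeated characteristic roots need no separate treatment.
\<close>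

section \<open>Homogeneous Vandermonde determinants\<close>

lemma det_scale_rows:
  fixes g :: "nat \<Rightarrow> nat \<Rightarrow> 'a :: comm_ring_1"
  shows "det (mat n n (\<lambda>(i, j). d i * g i j)) = (\<Prod>i<n. d i) * det (mat n n (\<lambda>(i, j). g i j))"
proof -
  have "det (mat\<^sub>r n n (\<lambda>i. d i \<cdot>\<^sub>v vec n (g i))) = (\<Prod>i\<in>{0..<n}. d i) * det (mat\<^sub>r n n (\<lambda>i. vec n (g i)))"
    by (rule det_rows_mul) auto
  moreover have "mat\<^sub>r n n (\<lambda>i. d i \<cdot>\<^sub>v vec n (g i)) = mat n n (\<lambda>(i, j). d i * g i j)"
    by (rule eq_matI) auto
  moreover have "mat\<^sub>r n n (\<lambda>i. vec n (g i)) = mat n n (\<lambda>(i, j). g i j)"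
    by (rule eq_matI) auto
  ultimately show ?thesis
    by (simp add: lessThan_atLeast0)
qed

text \<open>Laplace expansion along row 0. The position \<open>l\<close> is kept general because the
  Vandermonde induction isolates the last entry when \<open>y 0 = 0\<close> and the first entry
  otherwise.\<close>

lemma det_single_entry_row_0:
  fixes A :: "'a :: comm_ring_1 mat"
  assumes A: "A \<in> carrier_mat (Suc n) (Suc n)" and l: "l \<le> n"
    and zero: "\<And>j. j \<le> n \<Longrightarrow> j \<noteq> l \<Longrightarrow> A $$ (0, j) = 0"
  shows "det A = A $$ (0, l) * ((-1) ^ l * det (mat_delete A 0 l))"
proof -
  have "det A = (\<Sum>j<Suc n. A $$ (0, j) * cofactor A 0 j)"
    by (rule laplace_expansion_row[OF A]) simp
  also have "\<dots> = (\<Sum>j\<in>{l}. A $$ (0, j) * cofactor A 0 j)"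
    using l zero by (intro sum.mono_neutral_right) auto
  finally show ?thesis
    by (simp add: cofactor_def)
qed

text \<open>Splits off the pairs with \<open>i = 0\<close>, matching the removal of row 0 and the
  shift of the nodes in the Vandermonde induction.\<close>

lemma prod_pairs_Suc_shift:
  fixes f :: "nat \<Rightarrow> nat \<Rightarrow> 'a :: comm_monoid_mult"
  shows "(\<Prod>j<Suc n. \<Prod>i<j. f i j) = (\<Prod>j<n. f 0 (Suc j)) * (\<Prod>j<n. \<Prod>i<j. f (Suc i) (Suc j))"
  by (simp only: prod.lessThan_Suc_shift lessThan_0 prod.empty prod.distrib mult_1)

text \<open>Once row 0 has a single entry that may be nonzero, the remaining minor is the same
  matrix for the shifted nodes with scaled rows; hence the induction generalises over
  \<open>x\<close> and \<open>y\<close>. The homogeneous form avoids quotients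
  \<open>x i / y i\<close>, so any \<open>y i\<close> may vanish.\<close>

lemma det_homogeneous_vandermonde:
  fixes x y :: "nat \<Rightarrow> 'a :: idom"
  shows "det (mat (Suc n) (Suc n) (\<lambda>(i, l). x i ^ l * y i ^ (n - l))) =
         (\<Prod>j<Suc n. \<Prod>i<j. x j * y i - x i * y j)"
proof (induction n arbitrary: x y)
  case 0
  show ?case by (simp add: det_single)
next
  case (Suc n)
  let ?N = "Suc (Suc n)"
  define V where "V = mat ?N ?N (\<lambda>(i, l). x i ^ l * y i ^ (Suc n - l))"
  have V: "V \<in> carrier_mat ?N ?N" by (simp add: V_def)
  define P where "P = (\<Prod>j<Suc n. \<Prod>i<j. x (Suc j) * y (Suc i) - x (Suc i) * y (Suc j))"
  have IH: "det (mat (Suc n) (Suc n) (\<lambda>(i, l). x (Suc i) ^ l * y (Suc i) ^ (n - l))) = P"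
    unfolding P_def by (rule Suc.IH)
  \<comment> \<open>The row factors \<open>d\<close> stay arbitrary: they are
    \<open>y (Suc i)\<close> if \<open>y 0 = 0\<close>, and
    \<open>x (Suc i) * y 0 - x 0 * y (Suc i)\<close> otherwise.\<close>
  have scaled: "det (mat (Suc n) (Suc n) (\<lambda>(i, l). d i * (x (Suc i) ^ l * y (Suc i) ^ (n - l))))
      = (\<Prod>i<Suc n. d i) * P" for d
    by (simp only: det_scale_rows IH)
  have "det V = (\<Prod>j<Suc n. x (Suc j) * y 0 - x 0 * y (Suc j)) * P"
  proof (cases "y 0 = 0")
    case True
    have "det V = V $$ (0, Suc n) * ((-1) ^ Suc n * det (mat_delete V 0 (Suc n)))"
      by (rule det_single_entry_row_0[OF V]) (auto simp: V_def True)
    also have "mat_delete V 0 (Suc n) =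
        mat (Suc n) (Suc n) (\<lambda>(i, l). y (Suc i) * (x (Suc i) ^ l * y (Suc i) ^ (n - l)))"
      by (rule eq_matI) (auto simp: V_def mat_delete_def Suc_diff_le)
    also have "V $$ (0, Suc n) = x 0 ^ Suc n"
      by (simp add: V_def)
    \<comment> \<open>The \<open>n + 1\<close> factors \<open>x 0\<close> and as many signs are
      distributed over the rows, which gives the pair factors at \<open>y 0 = 0\<close>.\<close>
    also have "x 0 ^ Suc n * ((-1) ^ Suc n *
        det (mat (Suc n) (Suc n) (\<lambda>(i, l). y (Suc i) * (x (Suc i) ^ l * y (Suc i) ^ (n - l)))))
        = (\<Prod>j<Suc n. - (x 0 * y (Suc j))) * P"
      unfolding scaled by (simp only: prod_uminus prod.distrib prod_constant card_lessThan mult_ac)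
    finally show ?thesis by (simp add: True)
  next
    case False
    \<comment> \<open>Replacing column \<open>l > 0\<close> by \<open>y 0\<close> times it minus \<open>x 0\<close> times its predecessor clears row 0 after its first entry.\<close>
    define T where "T = mat ?N ?N (\<lambda>(i, l). if i = l then (if l = 0 then 1 else y 0)
                                              else if Suc i = l then - x 0 else 0)"
    have T: "T \<in> carrier_mat ?N ?N" by (simp add: T_def)
    have "upper_triangular T" by (auto simp: T_def)
    then have "det T = prod_list (diag_mat T)" by (rule det_upper_triangular[OF _ T])
    also have "\<dots> = (\<Prod>i<?N. if i = 0 then 1 else y 0)"
      by (simp add: prod_list_diag_prod lessThan_atLeast0 T_def)
    also have "\<dots> = y 0 ^ Suc n"
      by (subst prod.lessThan_Suc_shift) simp
    finally have det_T: "det T = y 0 ^ Suc n" .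
    have VT: "V * T \<in> carrier_mat ?N ?N" using V T by simp
    have entry: "(V * T) $$ (i, l) = (\<Sum>m<?N. V $$ (i, m) * T $$ (m, l))" if "i < ?N" "l < ?N" for i l
      using that V T by (auto simp: times_mat_def scalar_prod_def lessThan_atLeast0)
    have entry_0: "(V * T) $$ (i, 0) = y i ^ Suc n" if "i < ?N" for i
    proof -
      have "(V * T) $$ (i, 0) = (\<Sum>m\<in>{0}. V $$ (i, m) * T $$ (m, 0))"
        unfolding entry[OF that zero_less_Suc] by (rule sum.mono_neutral_right) (auto simp: T_def)
      then show ?thesis using that by (simp add: V_def T_def)
    qed
    \<comment> \<open>The linear factor vanishes for \<open>i = 0\<close>, which clears row 0; in
      every other row it does not depend on \<open>l\<close> and can be pulled out.\<close>
    have entry_Suc: "(V * T) $$ (i, Suc l) = (x i * y 0 - x 0 * y i) * (x i ^ l * y i ^ (n - l))"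
      if "i < ?N" "l \<le> n" for i l
    proof -
      have "(V * T) $$ (i, Suc l) = (\<Sum>m\<in>{l, Suc l}. V $$ (i, m) * T $$ (m, Suc l))"
      proof (subst entry)
        show "(\<Sum>m<?N. V $$ (i, m) * T $$ (m, Suc l)) = (\<Sum>m\<in>{l, Suc l}. V $$ (i, m) * T $$ (m, Suc l))"
          using that by (intro sum.mono_neutral_right) (auto simp: T_def)
      qed (use that in auto)
      then show ?thesis using that by (simp add: V_def T_def Suc_diff_le algebra_simps)
    qed
    have "det (V * T) = (V * T) $$ (0, 0) * ((-1) ^ 0 * det (mat_delete (V * T) 0 0))"
    proof (rule det_single_entry_row_0[OF VT])
      fix j assume "j \<le> Suc n" "j \<noteq> 0"
      then show "(V * T) $$ (0, j) = 0"
        using entry_Suc[of 0 "j - 1"] by (cases j) auto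
    qed simp
    also have "mat_delete (V * T) 0 0 = mat (Suc n) (Suc n)
        (\<lambda>(i, l). (x (Suc i) * y 0 - x 0 * y (Suc i)) * (x (Suc i) ^ l * y (Suc i) ^ (n - l)))"
      using VT by (intro eq_matI) (auto simp: mat_delete_def entry_Suc simp del: index_mult_mat)
    \<comment> \<open>The factor \<open>y 0 ^ Suc n\<close> is \<open>det T\<close> on the left and
      the corner entry of \<open>V * T\<close> on the right; it cancels in an integral
      domain.\<close>
    finally have "det V * y 0 ^ Suc n =
        y 0 ^ Suc n * ((\<Prod>j<Suc n. x (Suc j) * y 0 - x 0 * y (Suc j)) * P)"
      unfolding scaled entry_0[OF zero_less_Suc] det_mult[OF V T] det_T by simp
    then show ?thesis using False by simp
  qed
  then show ?case
    unfolding V_def P_def prod_pairs_Suc_shift[of _ "Suc n"] .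
qed

lemma det_power_bilinear:
  fixes x y z w :: "nat \<Rightarrow> 'a :: idom"
  shows "det (mat (Suc r) (Suc r) (\<lambda>(i, j). (x i * z j + y i * w j) ^ r)) =
         (\<Prod>l\<le>r. of_nat (r choose l)) *
         (\<Prod>j<Suc r. \<Prod>i<j. (x j * y i - x i * y j) * (z j * w i - z i * w j))"
proof -
  let ?N = "Suc r"
  define A where "A = mat ?N ?N (\<lambda>(i, l). x i ^ l * y i ^ (r - l))"
  \<comment> \<open>The diagonal matrix of binomial coefficients is absorbed into the rows of
    \<open>B\<close>.\<close>
  define B where "B = mat ?N ?N (\<lambda>(l, j). of_nat (r choose l) * (z j ^ l * w j ^ (r - l)))"
  have A: "A \<in> carrier_mat ?N ?N" and B: "B \<in> carrier_mat ?N ?N"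
    by (simp_all add: A_def B_def)
  have "mat ?N ?N (\<lambda>(i, j). (x i * z j + y i * w j) ^ r) = A * B"
  proof (rule eq_matI)
    fix i j assume "i < dim_row (A * B)" "j < dim_col (A * B)"
    then have ij: "i < ?N" "j < ?N" by (simp_all add: A_def B_def)
    then have "(A * B) $$ (i, j) = (\<Sum>l<?N. A $$ (i, l) * B $$ (l, j))"
      using A B by (auto simp: times_mat_def scalar_prod_def lessThan_atLeast0)
    also have "\<dots> = (\<Sum>l\<le>r. of_nat (r choose l) * (x i * z j) ^ l * (y i * w j) ^ (r - l))"
      unfolding lessThan_Suc_atMost
      using ij by (intro sum.cong) (auto simp: A_def B_def power_mult_distrib)
    also have "\<dots> = (x i * z j + y i * w j) ^ r"
      by (rule binomial_ring[symmetric])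
    finally show "mat ?N ?N (\<lambda>(i, j). (x i * z j + y i * w j) ^ r) $$ (i, j) = (A * B) $$ (i, j)"
      using ij by simp
  qed (simp_all add: A_def B_def)
  moreover have "det A = (\<Prod>j<?N. \<Prod>i<j. x j * y i - x i * y j)"
    unfolding A_def by (rule det_homogeneous_vandermonde)
  moreover have "det B = (\<Prod>l<?N. of_nat (r choose l)) * (\<Prod>j<?N. \<Prod>i<j. z j * w i - z i * w j)"
  proof -
    have "mat ?N ?N (\<lambda>(l, j). z j ^ l * w j ^ (r - l)) =
          transpose_mat (mat ?N ?N (\<lambda>(j, l). z j ^ l * w j ^ (r - l)))"
      by (rule eq_matI) auto
    then have "det (mat ?N ?N (\<lambda>(l, j). z j ^ l * w j ^ (r - l))) =
               det (mat ?N ?N (\<lambda>(j, l). z j ^ l * w j ^ (r - l)))"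
      by (simp add: det_transpose[of _ ?N])
    then show ?thesis
      unfolding B_def by (simp only: det_scale_rows det_homogeneous_vandermonde)
  qed
  ultimately show ?thesis
    by (simp only: det_mult[OF A B] prod.distrib lessThan_Suc_atMost mult_ac)
qed

section \<open>Two-sided linear recurrences\<close>

text \<open>Induction from 0 in both directions on two consecutive values; going down, the
  recurrence is solved for its lowest term by cancelling \<open>c2\<close>.\<close>

lemma recurrence_unique:
  fixes f g :: "int \<Rightarrow> 'a :: field"
  assumes "c2 \<noteq> 0"
    and f: "\<And>m. f m = c1 * f (m - 1) + c2 * f (m - 2)"
    and g: "\<And>m. g m = c1 * g (m - 1) + c2 * g (m - 2)"
    and init: "f 0 = g 0" "f 1 = g 1"
  shows "f m = g m"
proof -
  have "f m = g m \<and> f (m + 1) = g (m + 1)"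
  proof (induction m rule: int_induct[where k = 0])
    case base
    show ?case using init by simp
  next
    case (step1 i)
    then show ?case using f[of "i + 2"] g[of "i + 2"] by (simp add: algebra_simps)
  next
    case (step2 i)
    have "c2 * f (i - 1) = c2 * g (i - 1)"
      using f[of "i + 1"] g[of "i + 1"] step2.IH by auto
    then have "f (i - 1) = g (i - 1)" using \<open>c2 \<noteq> 0\<close> by simp
    then show ?case using step2.IH by simp
  qed
  then show ?thesis ..
qed

text \<open>For fixed \<open>p\<close>, both sides satisfy the recurrence in \<open>q\<close> and
  agree at \<open>q = 0\<close> and \<open>q = 1\<close>.\<close>

lemma W_add:
  assumes "c2 \<noteq> 0"
  shows "W a b c1 c2 (p + q) =
         W 0 1 c1 c2 q * W a b c1 c2 (p + 1) + of_int c2 * W 0 1 c1 c2 (q - 1) * W a b c1 c2 p"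
proof -
  let ?W = "W a b c1 c2" and ?U = "W 0 1 c1 c2"
  show ?thesis
  proof (rule recurrence_unique[of "of_int c2" "\<lambda>q. ?W (p + q)" "of_int c1"
        "\<lambda>q. ?U q * ?W (p + 1) + of_int c2 * ?U (q - 1) * ?W p"])
    fix m
    show "?W (p + m) = of_int c1 * ?W (p + (m - 1)) + of_int c2 * ?W (p + (m - 2))"
      using W_rec[OF assms, of a b c1 "p + m"] by (simp add: algebra_simps)
    show "?U m * ?W (p + 1) + of_int c2 * ?U (m - 1) * ?W p =
        of_int c1 * (?U (m - 1) * ?W (p + 1) + of_int c2 * ?U (m - 1 - 1) * ?W p) +
        of_int c2 * (?U (m - 2) * ?W (p + 1) + of_int c2 * ?U (m - 2 - 1) * ?W p)"
      using W_rec[OF assms, of 0 1 c1 m] W_rec[OF assms, of 0 1 c1 "m - 1"]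
      by (simp add: algebra_simps)
  next
    \<comment> \<open>At \<open>q = 0\<close> the formula involves the term of \<open>U\<close> at
      index -1, which is the inverse of \<open>c2\<close>.\<close>
    have "of_int c2 * W 0 1 c1 c2 (-1) = 1"
      using W_rec[OF assms, of 0 1 c1 1] by (simp add: W_0 W_1)
    then show "W a b c1 c2 (p + 0) = W 0 1 c1 c2 0 * W a b c1 c2 (p + 1) +
        of_int c2 * W 0 1 c1 c2 (0 - 1) * W a b c1 c2 p"
      by (simp add: W_0)
  qed (use assms in \<open>simp_all add: W_0 W_1\<close>)
qed

text \<open>Shifting \<open>p\<close> by one multiplies the left side by \<open>- c2\<close>, the
  determinant of the companion matrix; at \<open>p = 0\<close> it is computed from the initial
  values.\<close>

lemma W_cassini:
  assumes "c2 \<noteq> 0"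
  shows "W a b c1 c2 (p + 2) * W a b c1 c2 p - W a b c1 c2 (p + 1) ^ 2 =
         - of_int (b\<^sup>2 - c1 * a * b - c2 * a\<^sup>2) * (- of_int c2) powi p"
proof -
  let ?W = "W a b c1 c2"
  have rec: "?W (m + 2) = of_int c1 * ?W (m + 1) + of_int c2 * ?W m" for m
    using W_rec[OF assms, of a b c1 "m + 2"] by (simp add: algebra_simps)
  define D where "D p = ?W (p + 2) * ?W p - ?W (p + 1) ^ 2" for p
  have D_step: "D (p + 1) = - of_int c2 * D p" for p
    using rec[of p] rec[of "p + 1"]
    by (simp add: D_def add.assoc power2_eq_square) (simp add: algebra_simps)
  have "D p = D 0 * (- of_int c2) powi p"
  proof (induction p rule: int_induct[where k = 0])
    case base
    show ?case by simp
  next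
    case (step1 i)
    then show ?case using D_step[of i] assms by (simp add: power_int_add)
  next
    case (step2 i)
    then show ?case using D_step[of "i - 1"] assms
      by (simp add: power_int_diff field_simps)
  qed
  moreover have "D 0 = - of_int (b\<^sup>2 - c1 * a * b - c2 * a\<^sup>2)"
    using rec[of 0] by (simp add: D_def W_0 W_1 power2_eq_square algebra_simps)
  ultimately show ?thesis by (simp add: D_def)
qed

text \<open>Expanding both shifted terms by the addition formula, the parts with
  \<open>U (d - 1)\<close> cancel, leaving \<open>U d\<close> times the Cassini expression.\<close>

lemma W_docagne:
  assumes "c2 \<noteq> 0"
  shows "W a b c1 c2 (p + d + 1) * W a b c1 c2 p - W a b c1 c2 (p + 1) * W a b c1 c2 (p + d) =
         - of_int (b\<^sup>2 - c1 * a * b - c2 * a\<^sup>2) * (- of_int c2) powi p * W 0 1 c1 c2 d"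
proof -
  have "W a b c1 c2 (p + d + 1) * W a b c1 c2 p - W a b c1 c2 (p + 1) * W a b c1 c2 (p + d) =
        W 0 1 c1 c2 d * (W a b c1 c2 (p + 2) * W a b c1 c2 p - W a b c1 c2 (p + 1) ^ 2)"
    using W_add[OF assms, of a b c1 p d] W_add[OF assms, of a b c1 "p + 1" d]
    by (simp add: algebra_simps power2_eq_square)
  then show ?thesis
    by (simp add: W_cassini[OF assms])
qed

section \<open>Products over pairs\<close>

text \<open>The index \<open>d\<close> occurs once for each \<open>j\<close> with
  \<open>d < j \<le> r\<close>, hence \<open>r - d\<close> times.\<close>

lemma prod_pairs_index:
  fixes g :: "nat \<Rightarrow> 'a :: comm_monoid_mult"
  shows "(\<Prod>j<Suc r. \<Prod>d<j. g d) = (\<Prod>d\<le>r. g d ^ (r - d))"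
proof (induction r)
  case (Suc r)
  have "(\<Prod>d\<le>Suc r. g d ^ (Suc r - d)) = (\<Prod>d\<le>r. g d ^ (r - d) * g d)"
    by (simp add: Suc_diff_le mult.commute)
  with Suc show ?case
    by (simp add: prod.distrib lessThan_Suc_atMost)
qed simp

lemma prod_geometric:
  fixes q E :: "'a :: field"
  assumes "q \<noteq> 0"
  shows "(\<Prod>i<N. E * q powi (m + 2 * k * int i)) =
         E ^ N * q powi (m * int N + 2 * k * int (N choose 2))"
proof (induction N)
  case (Suc N)
  have "m * int (Suc N) + 2 * k * int (Suc N choose 2) =
        (m * int N + 2 * k * int (N choose 2)) + (m + 2 * k * int N)"
    by (simp add: numeral_2_eq_2 algebra_simps)
  with Suc assms show ?case by (simp add: power_int_add)
qed (simp add: binomial_eq_0)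

text \<open>Summing the exponents \<open>m * j + 2 * k * (j choose 2)\<close> over
  \<open>j < N\<close> by Pascal's rule produces \<open>N choose 2\<close> and
  \<open>N choose 3\<close>.\<close>

lemma prod_pairs_geometric:
  fixes q E :: "'a :: field"
  assumes q: "q \<noteq> 0"
  shows "(\<Prod>j<N. \<Prod>i<j. E * q powi (m + 2 * k * int i)) =
         E ^ (N choose 2) * q powi (m * int (N choose 2) + 2 * k * int (N choose 3))"
proof (induction N)
  case (Suc N)
  have "m * int (Suc N choose 2) + 2 * k * int (Suc N choose 3) =
        (m * int (N choose 2) + 2 * k * int (N choose 3)) + (m * int N + 2 * k * int (N choose 2))"
    by (simp add: numeral_2_eq_2 numeral_3_eq_3 algebra_simps)
  moreover have "Suc N choose 2 = (N choose 2) + N"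
    by (simp add: numeral_2_eq_2)
  ultimately show ?case
    using q power_int_add[of q]
    by (subst prod.lessThan_Suc, subst Suc, subst prod_geometric) (simp_all only: power_add mult_ac simp_thms)
qed (simp add: binomial_eq_0)

section \<open>Evaluation of the pair products for the matrix of powers\<close>

theorem theorem5:
  fixes a0 a1 c1 c2 :: int and r :: nat and s k n :: int
  assumes "c2 \<noteq> 0"
  defines "\<Delta> \<equiv> a1\<^sup>2 - c1 * a0 * a1 - c2 * a0\<^sup>2"
  shows "det (mat (r + 1) (r + 1)
             (\<lambda>(i, j). W a0 a1 c1 c2 (s + k * (n + int i + int j)) ^ r)) =
         (- 1) powi ((s + k * n + 1) * int ((r + 1) choose 2)) *
         of_int c2 powi ((s + k * n) * int ((r + 1) choose 2) + 2 * k * int ((r + 1) choose 3)) *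
         of_int \<Delta> ^ ((r + 1) choose 2) *
         (\<Prod>i = 0..r. of_nat (r choose i) * W 0 1 c1 c2 (int (i + 1) * k) ^ (2 * (r - i)))"
proof -
  let ?W = "W a0 a1 c1 c2" and ?U = "W 0 1 c1 c2"
  let ?N = "Suc r"
  define m where "m = s + k * n"
  define q :: rat where "q = - of_int c2"
  have q: "q \<noteq> 0" using assms(1) by (simp add: q_def)
  \<comment> \<open>These four come from the addition formula with base index
    \<open>m + k * int j\<close> and shift \<open>k * int i\<close>: \<open>x\<close> and
    \<open>y\<close> depend on the row only, \<open>z\<close> and \<open>w\<close> on the column
    only.\<close>
  define x where "x i = ?U (k * int i)" for i :: nat
  define y where "y i = of_int c2 * ?U (k * int i - 1)" for i :: nat
  define z where "z j = ?W (m + k * int j + 1)" for j :: nat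
  define w where "w j = ?W (m + k * int j)" for j :: nat
  have index: "s + k * (n + int i + int j) = (m + k * int j) + k * int i" for i j
    by (simp add: m_def algebra_simps)
  have xy: "x j * y i - x i * y j = q powi (k * int i) * ?U (k * (int j - int i))" for i j
  proof -
    have "x j * y i - x i * y j = of_int c2 * (?U (k * int j) * ?U (k * int i - 1) - ?U (k * int i) * ?U (k * int j - 1))"
      by (simp add: x_def y_def algebra_simps)
    \<comment> \<open>This is d'Ocagne's identity for \<open>U\<close> itself, where
      \<open>b\<^sup>2 - c1 * a * b - c2 * a\<^sup>2\<close> equals 1. The prefactor
      \<open>- of_int c2\<close> is \<open>q\<close> and absorbs the offset -1 in the
      exponent.\<close>
    also have "\<dots> = - of_int c2 * q powi (k * int i - 1) * ?U (k * (int j - int i))"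
    proof -
      have "k * int i - 1 + k * (int j - int i) + 1 = k * int j"
        "k * int i - 1 + k * (int j - int i) = k * int j - 1"
        "k * int i - 1 + 1 = k * int i"
        by (simp_all add: algebra_simps)
      then show ?thesis
        using W_docagne[OF assms(1), of 0 1 c1 "k * int i - 1" "k * (int j - int i)"]
        by (simp only: q_def) simp
    qed
    also have "- of_int c2 * q powi (k * int i - 1) = q powi (k * int i)"
      using power_int_minus_mult[of q "k * int i"] q by (simp add: q_def mult.commute)
    finally show ?thesis .
  qed
  have zw: "z j * w i - z i * w j = - of_int \<Delta> * q powi (m + k * int i) * ?U (k * (int j - int i))" for i j
    using W_docagne[OF assms(1), of a0 a1 c1 "m + k * int i" "k * (int j - int i)"]
    by (simp add: z_def w_def q_def \<Delta>_def algebra_simps)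
  \<comment> \<open>Each pair splits into a geometric factor depending on \<open>i\<close> alone and
    a square of \<open>U\<close> depending on the gap \<open>j - i\<close> alone.\<close>
  have "(\<Prod>j<?N. \<Prod>i<j. (x j * y i - x i * y j) * (z j * w i - z i * w j)) =
        (\<Prod>j<?N. \<Prod>i<j. (- of_int \<Delta> * q powi (m + 2 * k * int i)) * ?U (k * (int j - int i)) ^ 2)"
  proof (intro prod.cong refl)
    fix i j :: nat
    have "q powi (m + 2 * k * int i) = q powi (k * int i) * q powi (m + k * int i)"
      using q by (simp add: power_int_add[symmetric] algebra_simps)
    then show "(x j * y i - x i * y j) * (z j * w i - z i * w j) =
        (- of_int \<Delta> * q powi (m + 2 * k * int i)) * ?U (k * (int j - int i)) ^ 2"
      by (simp add: xy zw power2_eq_square)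
  qed
  also have "\<dots> = (\<Prod>j<?N. \<Prod>i<j. - of_int \<Delta> * q powi (m + 2 * k * int i)) *
                  (\<Prod>j<?N. \<Prod>i<j. ?U (k * (int j - int i)) ^ 2)"
    by (simp only: prod.distrib)
  \<comment> \<open>Reversing the inner product, with \<open>d = j - i - 1\<close>, turns the gap
    into \<open>d + 1\<close>.\<close>
  also have "(\<Prod>j<?N. \<Prod>i<j. ?U (k * (int j - int i)) ^ 2) = (\<Prod>j<?N. \<Prod>d<j. ?U (int (d + 1) * k) ^ 2)"
  proof (rule prod.cong[OF refl])
    fix j :: nat
    show "(\<Prod>i<j. ?U (k * (int j - int i)) ^ 2) = (\<Prod>d<j. ?U (int (d + 1) * k) ^ 2)"
      by (subst prod.nat_diff_reindex[symmetric]) (auto intro!: prod.cong simp: of_nat_diff algebra_simps)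
  qed
  also have "\<dots> = (\<Prod>d\<le>r. ?U (int (d + 1) * k) ^ (2 * (r - d)))"
    by (simp only: prod_pairs_index power_mult)
  also have "(\<Prod>j<?N. \<Prod>i<j. - of_int \<Delta> * q powi (m + 2 * k * int i)) =
      (- 1) powi ((m + 1) * int (?N choose 2)) *
      of_int c2 powi (m * int (?N choose 2) + 2 * k * int (?N choose 3)) * of_int \<Delta> ^ (?N choose 2)"
  proof -
    define e where "e = m * int (?N choose 2) + 2 * k * int (?N choose 3)"
    have "q powi e = (-1) powi e * of_int c2 powi e"
      by (simp add: q_def flip: power_int_mult_distrib)
    \<comment> \<open>The part of \<open>e\<close> with \<open>?N choose 3\<close> is even and
      leaves no sign; the signs of the \<open>?N choose 2\<close> factors
      \<open>- of_int \<Delta>\<close> turn \<open>m\<close> into \<open>m + 1\<close>.\<close>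
    moreover have "(-1 :: rat) powi e * (-1) ^ (?N choose 2) = (-1) powi ((m + 1) * int (?N choose 2))"
    proof -
      have "(-1 :: rat) powi (2 * k * int (?N choose 3)) = 1"
        by (simp add: power_int_mult)
      then show ?thesis
        by (simp add: e_def power_int_add distrib_right)
    qed
    moreover have "(- of_int \<Delta> :: rat) ^ (?N choose 2) = (-1) ^ (?N choose 2) * of_int \<Delta> ^ (?N choose 2)"
      by (rule power_minus)
    ultimately show ?thesis
      unfolding prod_pairs_geometric[OF q] e_def[symmetric] by (metis mult.assoc mult.commute)
  qed
  finally have pairs: "(\<Prod>j<?N. \<Prod>i<j. (x j * y i - x i * y j) * (z j * w i - z i * w j)) =
      (- 1) powi ((m + 1) * int (?N choose 2)) *
      of_int c2 powi (m * int (?N choose 2) + 2 * k * int (?N choose 3)) * of_int \<Delta> ^ (?N choose 2) *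
      (\<Prod>d\<le>r. ?U (int (d + 1) * k) ^ (2 * (r - d)))" .
  have "?W (s + k * (n + int i + int j)) = x i * z j + y i * w j" for i j
    unfolding index x_def y_def z_def w_def by (rule W_add[OF assms(1)])
  then have "det (mat (r + 1) (r + 1) (\<lambda>(i, j). ?W (s + k * (n + int i + int j)) ^ r)) =
        det (mat ?N ?N (\<lambda>(i, j). (x i * z j + y i * w j) ^ r))"
    by simp
  then show ?thesis
    unfolding det_power_bilinear pairs
    by (simp only: m_def prod.distrib atLeast0AtMost Suc_eq_plus1 mult_ac)
qed

end
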